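(* In the variety of $2$-dimensional Novikov--Poisson algebras over $\mathbb C$, write $\overline{O(N_i^{*})}$ for the closure of the union of the orbits of all members of the family $N_i$ (over all complex parameter values). Then, with $\alpha,\beta$ ranging over all of $\mathbb C$: (i) $\overline{O(N_{06}^{*})}$ contains the orbit closures of $N_{05},N_{02},N_{01},\mathbb C^8$; (ii) $\overline{O(N_{07}^{*})}$ contains the orbit closures of $N_{14}^{\alpha},N_{12}^{1},N_{11}^{\alpha},N_{10}^{\alpha},N_{09}^{\alpha,\alpha},N_{08}^{\alpha,\alpha},N_{06}^{1},N_{04},N_{03},N_{01},\mathbb C^8$; (iii) $\overline{O(N_{08}^{*})}$ contains the orbit closures of $N_{14}^{\alpha},N_{13}^{\alpha},N_{12}^{\alpha},N_{09}^{\alpha,\beta},N_{06}^{\alpha},N_{05},N_{02},N_{01},\mathbb C^8$; (iv) $\overline{O(N_{09}^{*})}$ contains the orbit closures of $N_{14}^{\alpha},N_{13}^{\alpha},N_{06}^{\alpha},N_{05},N_{02},N_{01},\mathbb C^8$; (v) $\overline{O(N_{10}^{*})}$ contains the orbit closures of $N_{14}^{\alpha},N_{12}^{1},N_{11}^{\alpha},N_{06}^{1},N_{04},N_{03},N_{01},\mathbb C^8$; (vi) $\overline{O(N_{11}^{*})}$ contains the orbit closures of $N_{14}^{\alpha},N_{04},N_{01},\mathbb C^8$; (vii) $\overline{O(N_{12}^{*})}$ contains the orbit closures of $N_{14}^{\alpha},N_{13}^{\alpha},N_{06}^{\alpha},N_{05},N_{02},N_{01},\mathbb C^8$; (viii)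 $\overline{O(N_{13}^{*})}$ contains the orbit closures of $N_{14}^{\alpha},N_{06}^{0},N_{05},N_{01},\mathbb C^8$; (ix) $\overline{O(N_{14}^{*})}$ contains the orbit closures of $N_{01},\mathbb C^8$.
   Context: A Novikov--Poisson algebra is a complex vector space with a commutative associative product $\cdot$ and a Novikov product $\circ$, i.e. a bilinear product with $(x\circ y)\circ z-x\circ(y\circ z)=(y\circ x)\circ z-y\circ(x\circ z)$ and $(x\circ y)\circ z=(x\circ z)\circ y$, such that $(x\cdot y)\circ z=x\cdot(y\circ z)$ and $(x\circ y)\cdot z-(y\circ x)\cdot z=x\circ(y\cdot z)-y\circ(x\cdot z)$. Fix a $2$-dimensional complex vector space $V$ with basis $e_1,e_2$. A $2$-dimensional such algebra is viewed as a pair $(\mu,\mu')\in \mathrm{Bil}(V\times V,V)^2\cong\mathbb C^{16}$ ($\mu$ is $\cdot$, $\mu'$ is $\circ$). $\mathrm{GL}(V)$ acts by $(g*(\mu,\mu'))(x,y)=(g\mu(g^{-1}x,g^{-1}y),\,g\mu'(g^{-1}x,g^{-1}y))$; $O(T)$ is the orbit of a structure representing $T$; closures are Zariski closures. The algebras are (unlisted products are zero, $\cdot$ is commutative): $N_{01}: e_1\circ e_1=e_2$; $N_{02}: e_2\circ e_1=-e_1$; $N_{03}: e_1\circ e_1=e_1,\ e_2\circ e_2=e_2$; $N_{04}: e_1\circ e_1=e_1$; $N_{05}: e_1\circ e_2=e_1,\ e_2\circ e_2=e_1+e_2$; $N_{06}^{\gamma}: e_1\circ e_2=e_1,\ e_2\circ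 e_1=\gamma e_1,\ e_2\circ e_2=e_2$; $N_{07}^{\alpha,\beta}: e_1\cdot e_1=e_1,\ e_2\cdot e_2=e_2,\ e_1\circ e_1=\alpha e_1,\ e_2\circ e_2=\beta e_2$; $N_{08}^{\alpha,\beta}: e_1\cdot e_1=e_1,\ e_1\cdot e_2=e_2,\ e_1\circ e_1=\alpha e_1+e_2,\ e_1\circ e_2=\beta e_2,\ e_2\circ e_1=\alpha e_2$; $N_{09}^{\alpha,\beta}: e_1\cdot e_1=e_1,\ e_1\cdot e_2=e_2,\ e_1\circ e_1=\alpha e_1,\ e_1\circ e_2=\beta e_2,\ e_2\circ e_1=\alpha e_2$; $N_{10}^{\alpha}: e_1\cdot e_1=e_1,\ e_1\circ e_1=\alpha e_1,\ e_2\circ e_2=e_2$; $N_{11}^{\alpha}: e_1\cdot e_1=e_1,\ e_1\circ e_1=\alpha e_1$; $N_{12}^{\alpha}: e_1\cdot e_1=e_2,\ e_1\circ e_1=\alpha e_1,\ e_1\circ e_2=e_2,\ e_2\circ e_1=\alpha e_2$; $N_{13}^{\alpha}: e_1\cdot e_1=e_2,\ e_1\circ e_1=e_1+\alpha e_2,\ e_2\circ e_1=e_2$; $N_{14}^{\alpha}: e_1\cdot e_1=e_2,\ e_1\circ e_1=\alpha e_2$; $\mathbb C^8$: the algebra with both products zero. ($N_{01}$--$N_{06}$ have $\cdot=0$.) *)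

theory Defs
  imports "HOL-Analysis.Analysis"
begin

type_synonym V = "complex ^ 2"
type_synonym pair_structure = "(V \<Rightarrow> V \<Rightarrow> V) \<times> (V \<Rightarrow> V \<Rightarrow> V)"

text \<open>The library's \<open>linear\<close> and \<open>bilinear\<close> are over the reals; here everything is
  over the complex numbers, with scalar multiplication \<open>*s\<close>.\<close>

abbreviation clinear_map :: "(V \<Rightarrow> V) \<Rightarrow> bool" where
  "clinear_map \<equiv> Vector_Spaces.linear (*s) (*s)"

definition cbilinear :: "(V \<Rightarrow> V \<Rightarrow> V) \<Rightarrow> bool" where
  "cbilinear m \<longleftrightarrow> (\<forall>x. clinear_map (\<lambda>y. m x y)) \<and> (\<forall>y. clinear_map (\<lambda>x. m x y))"

definition Bil2 :: "pair_structure set" where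
  "Bil2 = {(m, m'). cbilinear m \<and> cbilinear m'}"

definition NP2 :: "pair_structure set" where
  "NP2 = {(d, c) \<in> Bil2.
     (\<forall>x y. d x y = d y x) \<and>
     (\<forall>x y z. d (d x y) z = d x (d y z)) \<and>
     (\<forall>x y z. c (c x y) z - c x (c y z) = c (c y x) z - c y (c x z)) \<and>
     (\<forall>x y z. c (c x y) z = c (c x z) y) \<and>
     (\<forall>x y z. c (d x y) z = d x (c y z)) \<and>
     (\<forall>x y z. d (c x y) z - d (c y x) z = c x (d y z) - c y (d x z))}"

definition GL :: "(V \<Rightarrow> V) set" where
  "GL = {g. clinear_map g \<and> bij g}"

definition act :: "(V \<Rightarrow> V) \<Rightarrow> pair_structure \<Rightarrow> pair_structure" where
  "act g = (\<lambda>(m, m'). (\<lambda>x y. g (m (inv g x) (inv g y)), \<lambda>x y. g (m' (inv g x) (inv g y))))"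

definition orbit :: "pair_structure \<Rightarrow> pair_structure set" where
  "orbit T = {act g T |g. g \<in> GL}"

definition e1 :: V where "e1 = axis 1 1"
definition e2 :: V where "e2 = axis 2 1"

text \<open>Polynomial functions on \<open>Bil2\<close>: the algebra generated by the constants and the sixteen
  structure constants with respect to \<open>e1, e2\<close>.\<close>

inductive poly_fun :: "(pair_structure \<Rightarrow> complex) \<Rightarrow> bool" where
  const: "poly_fun (\<lambda>_. a)"
| coord_fst: "poly_fun (\<lambda>T. fst T (axis i 1) (axis j 1) $ k)"
| coord_snd: "poly_fun (\<lambda>T. snd T (axis i 1) (axis j 1) $ k)"
| add: "poly_fun p \<Longrightarrow> poly_fun q \<Longrightarrow> poly_fun (\<lambda>T. p T + q T)"
| mult: "poly_fun p \<Longrightarrow> poly_fun q \<Longrightarrow> poly_fun (\<lambda>T. p T * q T)"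

definition zero_locus :: "(pair_structure \<Rightarrow> complex) set \<Rightarrow> pair_structure set" where
  "zero_locus P = {T \<in> Bil2. \<forall>p\<in>P. p T = 0}"

definition zariski_closed :: "pair_structure set \<Rightarrow> bool" where
  "zariski_closed Z \<longleftrightarrow> (\<exists>P \<subseteq> Collect poly_fun. Z = zero_locus P)"

definition zariski :: "pair_structure topology" where
  "zariski = topology (\<lambda>U. U \<subseteq> Bil2 \<and> zariski_closed (Bil2 - U))"

lemma zariski_closed_Un:
  assumes "zariski_closed A" "zariski_closed B"
  shows "zariski_closed (A \<union> B)"
proof -
  obtain P Q where P: "P \<subseteq> Collect poly_fun" "A = zero_locus P"
    and Q: "Q \<subseteq> Collect poly_fun" "B = zero_locus Q"
    using assms unfolding zariski_closed_def by blast
  let ?R = "(\<lambda>(p, q) T. p T * q T) ` (P \<times> Q)"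
  have "?R \<subseteq> Collect poly_fun"
    using P(1) Q(1) by (auto intro: poly_fun.mult)
  moreover have "A \<union> B = zero_locus ?R"
    unfolding P(2) Q(2) by (auto simp: zero_locus_def split_beta)
  ultimately show ?thesis unfolding zariski_closed_def by blast
qed

lemma zariski_closed_INT:
  assumes "\<And>U. U \<in> K \<Longrightarrow> zariski_closed (Bil2 - U)"
  shows "zariski_closed (Bil2 - \<Union>K)"
proof -
  have "\<forall>U\<in>K. \<exists>P. P \<subseteq> Collect poly_fun \<and> Bil2 - U = zero_locus P"
    using assms unfolding zariski_closed_def by simp
  then obtain P where P: "\<forall>U\<in>K. P U \<subseteq> Collect poly_fun \<and> Bil2 - U = zero_locus (P U)"
    by (rule bchoice[THEN exE])
  have "Bil2 - \<Union>K = zero_locus (\<Union>U\<in>K. P U)"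
  proof (rule set_eqI)
    fix T
    have "T \<notin> U \<longleftrightarrow> (\<forall>p\<in>P U. p T = 0)" if "T \<in> Bil2" "U \<in> K" for U
    proof -
      have "T \<in> Bil2 - U \<longleftrightarrow> T \<in> zero_locus (P U)"
        using P that(2) by simp
      with that(1) show ?thesis by (simp add: zero_locus_def)
    qed
    then show "T \<in> Bil2 - \<Union>K \<longleftrightarrow> T \<in> zero_locus (\<Union>U\<in>K. P U)"
      by (auto simp: zero_locus_def)
  qed
  moreover have "(\<Union>U\<in>K. P U) \<subseteq> Collect poly_fun" using P by blast
  ultimately show ?thesis unfolding zariski_closed_def by blast
qed

lemma istopology_zariski: "istopology (\<lambda>U. U \<subseteq> Bil2 \<and> zariski_closed (Bil2 - U))"
  unfolding istopology_def
proof (intro conjI allI impI)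
  fix S T
  assume "S \<subseteq> Bil2 \<and> zariski_closed (Bil2 - S)" "T \<subseteq> Bil2 \<and> zariski_closed (Bil2 - T)"
  then show "S \<inter> T \<subseteq> Bil2" "zariski_closed (Bil2 - S \<inter> T)"
    by (auto simp: Diff_Int intro: zariski_closed_Un)
next
  fix K
  assume "\<forall>U\<in>K. U \<subseteq> Bil2 \<and> zariski_closed (Bil2 - U)"
  then show "\<Union>K \<subseteq> Bil2" "zariski_closed (Bil2 - \<Union>K)"
    by (auto intro: zariski_closed_INT)
qed

lemma openin_zariski: "openin zariski U \<longleftrightarrow> U \<subseteq> Bil2 \<and> zariski_closed (Bil2 - U)"
  unfolding zariski_def topology_inverse'[OF istopology_zariski] ..

lemma topspace_zariski: "topspace zariski = Bil2"
proof -
  have "zariski_closed (Bil2 - Bil2)"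
    unfolding zariski_closed_def zero_locus_def
    by (rule exI[of _ "{\<lambda>_. 1}"]) (auto intro: poly_fun.const)
  then have "openin zariski Bil2" by (simp add: openin_zariski)
  then show ?thesis
    by (meson openin_subset openin_topspace openin_zariski subset_antisym)
qed

lemma closedin_zariski: "closedin zariski Z \<longleftrightarrow> zariski_closed Z"
proof -
  have "Z \<subseteq> Bil2" if "zariski_closed Z"
    using that unfolding zariski_closed_def zero_locus_def by blast
  then show ?thesis
    by (auto simp: closedin_def openin_zariski topspace_zariski double_diff)
qed

definition np_closure :: "pair_structure set \<Rightarrow> pair_structure set" where
  "np_closure S = subtopology zariski NP2 closure_of S"

text \<open>\<open>prod_tab a b c d\<close> is the bilinear product with
  \<open>e1 e1 = a, e1 e2 = b, e2 e1 = c, e2 e2 = d\<close>.\<close>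

definition prod_tab :: "V \<Rightarrow> V \<Rightarrow> V \<Rightarrow> V \<Rightarrow> V \<Rightarrow> V \<Rightarrow> V" where
  "prod_tab a b c d x y =
     (x$1 * y$1) *s a + (x$1 * y$2) *s b + (x$2 * y$1) *s c + (x$2 * y$2) *s d"

definition N01 :: pair_structure where
  "N01 = (prod_tab 0 0 0 0, prod_tab e2 0 0 0)"
definition N02 :: pair_structure where
  "N02 = (prod_tab 0 0 0 0, prod_tab 0 0 (- e1) 0)"
definition N03 :: pair_structure where
  "N03 = (prod_tab 0 0 0 0, prod_tab e1 0 0 e2)"
definition N04 :: pair_structure where
  "N04 = (prod_tab 0 0 0 0, prod_tab e1 0 0 0)"
definition N05 :: pair_structure where
  "N05 = (prod_tab 0 0 0 0, prod_tab 0 e1 0 (e1 + e2))"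
definition N06 :: "complex \<Rightarrow> pair_structure" where
  "N06 \<gamma> = (prod_tab 0 0 0 0, prod_tab 0 e1 (\<gamma> *s e1) e2)"
definition N07 :: "complex \<Rightarrow> complex \<Rightarrow> pair_structure" where
  "N07 \<alpha> \<beta> = (prod_tab e1 0 0 e2, prod_tab (\<alpha> *s e1) 0 0 (\<beta> *s e2))"
definition N08 :: "complex \<Rightarrow> complex \<Rightarrow> pair_structure" where
  "N08 \<alpha> \<beta> = (prod_tab e1 e2 e2 0, prod_tab (\<alpha> *s e1 + e2) (\<beta> *s e2) (\<alpha> *s e2) 0)"
definition N09 :: "complex \<Rightarrow> complex \<Rightarrow> pair_structure" where
  "N09 \<alpha> \<beta> = (prod_tab e1 e2 e2 0, prod_tab (\<alpha> *s e1) (\<beta> *s e2) (\<alpha> *s e2) 0)"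
definition N10 :: "complex \<Rightarrow> pair_structure" where
  "N10 \<alpha> = (prod_tab e1 0 0 0, prod_tab (\<alpha> *s e1) 0 0 e2)"
definition N11 :: "complex \<Rightarrow> pair_structure" where
  "N11 \<alpha> = (prod_tab e1 0 0 0, prod_tab (\<alpha> *s e1) 0 0 0)"
definition N12 :: "complex \<Rightarrow> pair_structure" where
  "N12 \<alpha> = (prod_tab e2 0 0 0, prod_tab (\<alpha> *s e1) e2 (\<alpha> *s e2) 0)"
definition N13 :: "complex \<Rightarrow> pair_structure" where
  "N13 \<alpha> = (prod_tab e2 0 0 0, prod_tab (e1 + \<alpha> *s e2) 0 e2 0)"
definition N14 :: "complex \<Rightarrow> pair_structure" where
  "N14 \<alpha> = (prod_tab e2 0 0 0, prod_tab (\<alpha> *s e2) 0 0 0)"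
definition C8 :: pair_structure where
  "C8 = (prod_tab 0 0 0 0, prod_tab 0 0 0 0)"

lemma cbilinear_prod_tab: "cbilinear (prod_tab a b c d)"
  unfolding cbilinear_def prod_tab_def
  unfolding Vector_Spaces.linear_iff
  by (intro conjI allI vec.vector_space_axioms)
    (simp_all only: vec_eq_iff simp_thms vector_add_component vector_smult_component distrib_left distrib_right ac_simps) 

lemma prod_tab_basis:
  "prod_tab a b c d e1 e1 = a" "prod_tab a b c d e1 e2 = b"
  "prod_tab a b c d e2 e1 = c" "prod_tab a b c d e2 e2 = d"
  by (simp_all add: prod_tab_def e1_def e2_def axis_def)

lemma listed_algebras_in_NP2:
  "N01 \<in> NP2" "N02 \<in> NP2" "N03 \<in> NP2" "N04 \<in> NP2" "N05 \<in> NP2" "N06 \<alpha> \<in> NP2"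
  "N07 \<alpha> \<beta> \<in> NP2" "N08 \<alpha> \<beta> \<in> NP2" "N09 \<alpha> \<beta> \<in> NP2" "N10 \<alpha> \<in> NP2" "N11 \<alpha> \<in> NP2"
  "N12 \<alpha> \<in> NP2" "N13 \<alpha> \<in> NP2" "N14 \<alpha> \<in> NP2" "C8 \<in> NP2"
  unfolding N01_def N02_def N03_def N04_def N05_def N06_def N07_def N08_def N09_def N10_def
    N11_def N12_def N13_def N14_def C8_def NP2_def Bil2_def
  by (simp_all add: cbilinear_prod_tab prod_tab_def e1_def e2_def axis_def vec_eq_iff forall_2
      algebra_simps)

lemma orbit_subset_NP2:
  assumes "T \<in> NP2"
  shows "orbit T \<subseteq> NP2"
proof -
  obtain d c where T: "T = (d, c)" by (cases T)
  have "act g T \<in> NP2" if g: "g \<in> GL" for g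
  proof -
    have lin: "clinear_map g" and bij: "bij g" using g by (auto simp: GL_def)
    have inv_g: "inv g (g x) = x" for x using bij by (simp add: bij_is_inj)
    interpret g: Vector_Spaces.linear "(*s)" "(*s)" g by (rule lin)
    have lin_inv: "clinear_map (inv g)"
      using bij lin
      by (metis bij_is_inj bij_is_surj inv_o_cancel surj_iff vec.linear_injective_left_inverse
          left_right_inverse_eq)
    have bil: "cbilinear (\<lambda>x y. g (m (inv g x) (inv g y)))" if "cbilinear m" for m
    proof -
      have "clinear_map (g \<circ> (\<lambda>y. m (inv g x) y) \<circ> inv g)"
        "clinear_map (g \<circ> (\<lambda>y. m y (inv g x)) \<circ> inv g)" for x
        using that lin lin_inv unfolding cbilinear_def
        by (blast intro: Vector_Spaces.linear_compose)+
      then show ?thesis unfolding cbilinear_def comp_def by blast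
    qed
    have comm: "d x y = d y x" and assoc: "d (d x y) z = d x (d y z)" for x y z
      using assms unfolding T NP2_def by blast+
    have lsym: "c (c x y) z - c x (c y z) = c (c y x) z - c y (c x z)"
      and rcomm: "c (c x y) z = c (c x z) y" for x y z
      using assms unfolding T NP2_def by blast+
    have compat1: "c (d x y) z = d x (c y z)"
      and compat2: "d (c x y) z - d (c y x) z = c x (d y z) - c y (d x z)" for x y z
      using assms unfolding T NP2_def by blast+
    have "cbilinear d" "cbilinear c"
      using assms unfolding T NP2_def Bil2_def by blast+
    then have "act g T \<in> Bil2"
      unfolding T Bil2_def act_def by (simp add: bil)
    then show ?thesis
      unfolding T NP2_def act_def
      by (simp only: mem_Collect_eq split_conv simp_thms inv_g g.diff[symmetric])
         (intro conjI allI arg_cong[of _ _ g] comm assoc lsym rcomm compat1 compat2)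
  qed
  then show ?thesis unfolding orbit_def by blast
qed

end

theory Submission
  imports Defs
begin

text \<open>Each family is moved by a basis change depending on a parameter \<open>t\<close> (the parameters of the
  family may depend on \<open>t\<close> as well) so that its structure constants become polynomial in \<open>t\<close> and
  specialise to those of the target at \<open>t = 0\<close>. Polynomial functions are continuous in the
  Euclidean topology, so a polynomial that vanishes along the curve for \<open>t \<noteq> 0\<close> also vanishes at
  \<open>t = 0\<close>. The remaining inclusions follow by transitivity.\<close>

section \<open>Degenerations along curves\<close>

text \<open>The Zariski closure of \<open>S\<close> is the zero locus of some set of polynomials.
  Each of them vanishes on \<open>S\<close>, hence at \<open>T\<close> by \<open>vanish\<close>. As
  \<open>S\<close> and \<open>T\<close> lie in \<open>NP2\<close>, the closure in the subspace sees
  \<open>T\<close> as well.\<close>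

lemma np_closureI:
  assumes S: "S \<subseteq> NP2" and T: "T \<in> NP2"
    and vanish: "\<And>p. poly_fun p \<Longrightarrow> (\<And>X. X \<in> S \<Longrightarrow> p X = 0) \<Longrightarrow> p T = 0"
  shows "T \<in> np_closure S"
proof -
  have Bil: "NP2 \<subseteq> Bil2" by (auto simp: NP2_def)
  have "zariski_closed (zariski closure_of S)"
    using closedin_closure_of closedin_zariski by blast
  then obtain P where P: "P \<subseteq> Collect poly_fun" "zariski closure_of S = zero_locus P"
    unfolding zariski_closed_def by blast
  have "S \<subseteq> zero_locus P"
    using closure_of_subset[of S zariski] S Bil P(2) by (simp add: topspace_zariski)
  then have "T \<in> zero_locus P"
    using vanish P(1) T Bil unfolding zero_locus_def by blast
  then have "T \<in> zariski closure_of (NP2 \<inter> S)"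
    using P(2) S by (simp add: Int_absorb1)
  then show ?thesis
    using T unfolding np_closure_def closure_of_subtopology by blast
qed

lemma np_closure_least:
  assumes "A \<subseteq> np_closure B"
  shows "np_closure A \<subseteq> np_closure B"
  using assms unfolding np_closure_def by (simp add: closure_of_minimal)

lemma np_closure_mono: "A \<subseteq> B \<Longrightarrow> np_closure A \<subseteq> np_closure B"
  unfolding np_closure_def by (rule closure_of_mono)

lemma GL_comp: "g \<in> GL \<Longrightarrow> h \<in> GL \<Longrightarrow> g \<circ> h \<in> GL"
  unfolding GL_def by (auto intro: bij_comp Vector_Spaces.linear_compose)

lemma act_comp: "g \<in> GL \<Longrightarrow> h \<in> GL \<Longrightarrow> act g (act h T) = act (g \<circ> h) T"
  by (cases T) (simp add: act_def GL_def o_inv_distrib)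

lemma orbit_subset: "X \<in> orbit Y \<Longrightarrow> orbit X \<subseteq> orbit Y"
  unfolding orbit_def by (auto simp: act_comp) (blast intro: GL_comp)

text \<open>A complex-linear map is real-linear, hence bounded in finite dimension, hence
  continuous.\<close>

lemma isCont_clinear:
  assumes "clinear_map g" "isCont f x"
  shows "isCont (\<lambda>t. g (f t)) x"
proof -
  interpret g: Vector_Spaces.linear "(*s)" "(*s)" g by (rule assms)
  have "r *\<^sub>R v = complex_of_real r *s v" for r and v :: V
    by (simp add: vec_eq_iff scaleR_conv_of_real[where 'a = complex])
  then have "linear g"
    by (intro linearI) (simp_all add: g.add g.scale)
  then have "isCont g v" for v
    by (simp add: linear_continuous_at linear_conv_bounded_linear)
  then show ?thesis using isCont_o2[OF assms(2)] by blast
qed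

lemma isCont_vector_smult [continuous_intros]:
  fixes f :: "'a::t2_space \<Rightarrow> complex" and g :: "'a \<Rightarrow> complex ^ 'n"
  assumes "isCont f x" "isCont g x"
  shows "isCont (\<lambda>t. f t *s g t) x"
  using assms unfolding isCont_def
  by (intro vec_tendstoI) (auto intro!: tendsto_intros)

text \<open>A polynomial function sees a structure only through the two products of basis vectors,
  so it is enough that these products vary continuously for each fixed pair of arguments.\<close>

lemma isCont_poly_fun:
  assumes "poly_fun p" "\<And>x y. isCont (\<lambda>t. fst (R t) x y) z" "\<And>x y. isCont (\<lambda>t. snd (R t) x y) z"
  shows "isCont (\<lambda>t. p (R t)) z"
  using assms by (induction rule: poly_fun.induct) (auto intro!: continuous_intros)

text \<open>Letting \<open>X t\<close> vary allows the parameters of a family to move along the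
  curve, even to infinity; a constant \<open>X\<close> describes the degeneration of a single
  algebra. \<open>B\<close> collects the parameters at which the basis change breaks down.
  Translating the whole curve by \<open>g\<close> reaches every point of the orbit of
  \<open>T\<close>, and the conclusion is the uniqueness of the limit of \<open>p\<close> along the
  translated curve.\<close>

lemma degeneration:
  fixes R :: "complex \<Rightarrow> pair_structure"
  assumes S: "S \<subseteq> NP2" and T: "R 0 = T" "T \<in> NP2" and B: "finite B"
    and R: "\<And>t. t \<notin> B \<Longrightarrow> R t \<in> orbit (X t)" and X: "\<And>t. orbit (X t) \<subseteq> S"
    and cont: "\<And>x y. isCont (\<lambda>t. fst (R t) x y) 0" "\<And>x y. isCont (\<lambda>t. snd (R t) x y) 0"
  shows "orbit T \<subseteq> np_closure S"
proof
  fix T' assume T': "T' \<in> orbit T"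
  then obtain g where g: "g \<in> GL" "T' = act g T" by (auto simp: orbit_def)
  show "T' \<in> np_closure S"
  proof (rule np_closureI[OF S])
    show "T' \<in> NP2" using T' orbit_subset_NP2[OF T(2)] by blast
    fix p assume p: "poly_fun p" "\<And>Y. Y \<in> S \<Longrightarrow> p Y = 0"
    have lin: "clinear_map g" using g by (simp add: GL_def)
    have "isCont (\<lambda>t. fst (act g (R t)) x y) 0" "isCont (\<lambda>t. snd (act g (R t)) x y) 0" for x y
      by (simp_all add: act_def split_beta isCont_clinear[OF lin] cont)
    then have "((\<lambda>t. p (act g (R t))) \<longlongrightarrow> p (act g (R 0))) (at 0)"
      using isCont_poly_fun[where R = "\<lambda>t. act g (R t)" and z = 0, OF p(1)] unfolding isCont_def by blast
    moreover have "eventually (\<lambda>t. p (act g (R t)) = 0) (at 0)"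
    proof -
      \<comment> \<open>The filter \<open>at 0\<close> leaves out 0 itself, so only
        \<open>B - {0}\<close> has to be avoided; it is finite, and its complement is an open
        neighbourhood of 0.\<close>
      have "eventually (\<lambda>t. t \<notin> B) (at 0)"
        using B unfolding eventually_at_topological
        by (intro exI[of _ "- (B - {0})"]) (auto simp: open_Compl finite_imp_closed simp del: Compl_Diff_eq)
      then show ?thesis
      proof eventually_elim
        case (elim t)
        have "act g (R t) \<in> orbit (R t)" using g(1) by (auto simp: orbit_def)
        then show ?case using p(2) orbit_subset[OF R[OF elim]] X by blast
      qed
    qed
    ultimately show "p T' = 0"
      using tendsto_unique[OF at_neq_bot _ tendsto_eventually] T(1) g(2) by blast
  qed
qed

section \<open>Change of basis\<close>

definition frame :: "V \<Rightarrow> V \<Rightarrow> V \<Rightarrow> V" where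
  "frame p q x = x $ 1 *s p + x $ 2 *s q"

text \<open>The assumption says that the matrix with columns \<open>p\<close> and \<open>q\<close>
  has nonzero determinant.\<close>

lemma frame_in_GL:
  assumes "p $ 1 * q $ 2 \<noteq> p $ 2 * q $ 1"
  shows "frame p q \<in> GL"
proof -
  have lin: "clinear_map (frame p q)"
    unfolding Vector_Spaces.linear_iff
    by (intro conjI allI vec.vector_space_axioms)
      (simp_all add: frame_def vec_eq_iff algebra_simps)
  interpret h: Vector_Spaces.linear "(*s)" "(*s)" "frame p q" by (rule lin)
  have "inj (frame p q)"
    unfolding h.inj_iff_eq_0
  proof (intro allI impI)
    fix x assume "frame p q x = 0"
    then have e: "x $ 1 * p $ 1 + x $ 2 * q $ 1 = 0" "x $ 1 * p $ 2 + x $ 2 * q $ 2 = 0"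
      by (simp_all add: frame_def vec_eq_iff forall_2)
    \<comment> \<open>Cramer's rule: eliminate one unknown at a time, leaving the determinant as
      coefficient.\<close>
    then have "x $ 1 * (p $ 1 * q $ 2 - p $ 2 * q $ 1) = 0"
      "x $ 2 * (p $ 1 * q $ 2 - p $ 2 * q $ 1) = 0"
      by algebra+
    then show "x = 0" using assms by (simp add: vec_eq_iff forall_2)
  qed
  then have "bij (frame p q)"
    using vec.linear_inj_imp_surj[OF lin] by (simp add: bij_def)
  then show ?thesis using lin by (simp add: GL_def)
qed

text \<open>Both sides are bilinear in \<open>x\<close> and \<open>y\<close>, so agreement on the
  four pairs of basis vectors suffices.\<close>

lemma frame_prod_tab:
  assumes "frame p q a' = prod_tab a b c d p p" "frame p q b' = prod_tab a b c d p q"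
    "frame p q c' = prod_tab a b c d q p" "frame p q d' = prod_tab a b c d q q"
  shows "frame p q (prod_tab a' b' c' d' x y) = prod_tab a b c d (frame p q x) (frame p q y)"
proof -
  have "frame p q (prod_tab a' b' c' d' x y)
      = prod_tab (frame p q a') (frame p q b') (frame p q c') (frame p q d') x y"
    by (simp add: frame_def prod_tab_def vec_eq_iff algebra_simps)
  also have "\<dots> = prod_tab a b c d (frame p q x) (frame p q y)"
    unfolding assms by (simp add: frame_def prod_tab_def vec_eq_iff algebra_simps)
  finally show ?thesis .
qed

text \<open>The primed vectors are the structure constants of the same algebra in the basis
  \<open>p\<close>, \<open>q\<close>. Comparing them after applying \<open>frame p q\<close> keeps
  inverse matrices out of the conditions to be checked.\<close>

lemma in_orbitI:
  assumes indep: "p $ 1 * q $ 2 \<noteq> p $ 2 * q $ 1"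
    and "frame p q a' = prod_tab a b c d p p" "frame p q b' = prod_tab a b c d p q"
    "frame p q c' = prod_tab a b c d q p" "frame p q d' = prod_tab a b c d q q"
    and "frame p q u' = prod_tab u v w z p p" "frame p q v' = prod_tab u v w z p q"
    "frame p q w' = prod_tab u v w z q p" "frame p q z' = prod_tab u v w z q q"
  shows "(prod_tab a' b' c' d', prod_tab u' v' w' z') \<in> orbit (prod_tab a b c d, prod_tab u v w z)"
proof -
  let ?h = "frame p q"
  have h: "clinear_map ?h" "bij ?h" using frame_in_GL[OF indep] by (auto simp: GL_def)
  have inv: "inv ?h (?h x) = x" for x using h(2) by (simp add: bij_is_inj)
  have "clinear_map (inv ?h)"
    using h
    by (metis bij_is_inj bij_is_surj inv_o_cancel surj_iff vec.linear_injective_left_inverse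
        left_right_inverse_eq)
  then have "inv ?h \<in> GL" using h(2) by (simp add: GL_def bij_imp_bij_inv)
  \<comment> \<open>Acting by the inverse of the frame evaluates products at frame images, since
    \<open>act\<close> itself inverts its argument.\<close>
  moreover have "act (inv ?h) (prod_tab a b c d, prod_tab u v w z)
      = (prod_tab a' b' c' d', prod_tab u' v' w' z')"
    by (simp add: act_def inv_inv_eq[OF h(2)] inv
        frame_prod_tab[OF assms(2-5), symmetric] frame_prod_tab[OF assms(6-9), symmetric])
  ultimately show ?thesis unfolding orbit_def by force
qed

lemma families_subset_NP2:
  "orbit N01 \<subseteq> NP2" "orbit N05 \<subseteq> NP2" "orbit (N08 \<alpha> \<beta>) \<subseteq> NP2" "orbit (N10 \<alpha>) \<subseteq> NP2" "orbit (N11 \<alpha>) \<subseteq> NP2"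
  "orbit (N12 \<alpha>) \<subseteq> NP2" "orbit (N13 \<alpha>) \<subseteq> NP2"
  "(\<Union>\<gamma>. orbit (N06 \<gamma>)) \<subseteq> NP2" "(\<Union>\<gamma> \<delta>. orbit (N07 \<gamma> \<delta>)) \<subseteq> NP2"
  "(\<Union>\<gamma> \<delta>. orbit (N08 \<gamma> \<delta>)) \<subseteq> NP2" "(\<Union>\<gamma> \<delta>. orbit (N09 \<gamma> \<delta>)) \<subseteq> NP2"
  "(\<Union>\<gamma>. orbit (N10 \<gamma>)) \<subseteq> NP2" "(\<Union>\<gamma>. orbit (N11 \<gamma>)) \<subseteq> NP2"
  "(\<Union>\<gamma>. orbit (N12 \<gamma>)) \<subseteq> NP2" "(\<Union>\<gamma>. orbit (N13 \<gamma>)) \<subseteq> NP2" "(\<Union>\<gamma>. orbit (N14 \<gamma>)) \<subseteq> NP2"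
  by (intro UN_least orbit_subset_NP2 listed_algebras_in_NP2)+

section \<open>The primary degenerations\<close>

text \<open>In each proof, \<open>p\<close> and \<open>q\<close> are the new basis vectors and \<open>R t\<close> lists the structure
  constants with respect to them.\<close>

lemmas table_simps = frame_def prod_tab_def e1_def e2_def axis_def vec_eq_iff forall_2

section \<open>Algebras with zero commutative product\<close>

lemma N06_degenerates_to_N05: "orbit N05 \<subseteq> np_closure (\<Union>\<gamma>. orbit (N06 \<gamma>))"
proof (rule degeneration[where B = "{0}" and X = "\<lambda>t. N06 t"
      and R = "\<lambda>t. (prod_tab 0 0 0 0,
        prod_tab 0 e1 (t *s e1) (e1 + e2))"])
  fix t :: complex assume "t \<notin> {0}"
  then show "(prod_tab 0 0 0 0,
      prod_tab 0 e1 (t *s e1) (e1 + e2)) \<in> orbit (N06 t)"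
    unfolding N06_def
    \<comment> \<open>The shear to e1 + e2 gives q \<circ> q = q + t e1, and \<open>p\<close> is
      scaled to be exactly this extra term.\<close>
    by (intro in_orbitI[where p = "t *s e1" and q = "e1 + e2"])
      (simp_all add: table_simps field_simps power2_eq_square power3_eq_cube)
qed (rule listed_algebras_in_NP2 families_subset_NP2
  | force simp: N05_def prod_tab_def intro!: continuous_intros)+

lemma N06_degenerates_to_N02: "orbit N02 \<subseteq> np_closure (\<Union>\<gamma>. orbit (N06 \<gamma>))"
proof (rule degeneration[where B = "{0}" and X = "\<lambda>t. N06 (1 / t)"
      and R = "\<lambda>t. (prod_tab 0 0 0 0,
        prod_tab 0 ((- t) *s e1) (- e1) ((- t) *s e2))"])
  fix t :: complex assume "t \<notin> {0}"
  then show "(prod_tab 0 0 0 0,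
      prod_tab 0 ((- t) *s e1) (- e1) ((- t) *s e2)) \<in> orbit (N06 (1 / t))"
    unfolding N06_def
    by (intro in_orbitI[where p = "e1" and q = "(- t) *s e2"])
      (simp_all add: table_simps field_simps power2_eq_square power3_eq_cube)
qed (rule listed_algebras_in_NP2 families_subset_NP2
  | force simp: N02_def prod_tab_def intro!: continuous_intros)+

lemma N05_degenerates_to_N01: "orbit N01 \<subseteq> np_closure (orbit N05)"
proof (rule degeneration[where B = "{0}" and X = "\<lambda>t. N05"
      and R = "\<lambda>t. (prod_tab 0 0 0 0,
        prod_tab (t *s e1 + e2) 0 (t *s e2) 0)"])
  fix t :: complex assume "t \<notin> {0}"
  then show "(prod_tab 0 0 0 0,
      prod_tab (t *s e1 + e2) 0 (t *s e2) 0) \<in> orbit N05"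
    unfolding N05_def
    \<comment> \<open>The basis vectors swap roles: p \<circ> p = t^2 (e1 + e2) = t p + q.\<close>
    by (intro in_orbitI[where p = "t *s e2" and q = "t^2 *s e1"])
      (simp_all add: table_simps field_simps power2_eq_square power3_eq_cube)
qed (rule listed_algebras_in_NP2 families_subset_NP2
  | force simp: N01_def prod_tab_def intro!: continuous_intros)+

lemma N01_degenerates_to_C8: "orbit C8 \<subseteq> np_closure (orbit N01)"
proof (rule degeneration[where B = "{0}" and X = "\<lambda>t. N01"
      and R = "\<lambda>t. (prod_tab 0 0 0 0,
        prod_tab (t *s e2) 0 0 0)"])
  fix t :: complex assume "t \<notin> {0}"
  then show "(prod_tab 0 0 0 0,
      prod_tab (t *s e2) 0 0 0) \<in> orbit N01"
    unfolding N01_def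
    by (intro in_orbitI[where p = "e1" and q = "(1 / t) *s e2"])
      (simp_all add: table_simps field_simps power2_eq_square power3_eq_cube)
qed (rule listed_algebras_in_NP2 families_subset_NP2
  | force simp: C8_def prod_tab_def intro!: continuous_intros)+

section \<open>Algebras with nilpotent nonzero commutative product\<close>

lemma N13_degenerates_to_N14: "orbit (N14 \<alpha>) \<subseteq> np_closure (orbit (N13 \<alpha>))"
proof (rule degeneration[where B = "{0}" and X = "\<lambda>t. N13 \<alpha>"
      and R = "\<lambda>t. (prod_tab e2 0 0 0,
        prod_tab (t *s e1 + \<alpha> *s e2) 0 (t *s e2) 0)"])
  fix t :: complex assume "t \<notin> {0}"
  then show "(prod_tab e2 0 0 0,
      prod_tab (t *s e1 + \<alpha> *s e2) 0 (t *s e2) 0) \<in> orbit (N13 \<alpha>)"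
    unfolding N13_def
    \<comment> \<open>The weights 1 and 2 preserve e1 \<cdot> e1 = e2 and the \<alpha> e2 term, and
      multiply every other constant by t.\<close>
    by (intro in_orbitI[where p = "t *s e1" and q = "t^2 *s e2"])
      (simp_all add: table_simps field_simps power2_eq_square power3_eq_cube)
qed (rule listed_algebras_in_NP2 families_subset_NP2
  | force simp: N14_def prod_tab_def intro!: continuous_intros)+

lemma N13_degenerates_to_N06: "orbit (N06 0) \<subseteq> np_closure (orbit (N13 0))"
proof (rule degeneration[where B = "{0}" and X = "\<lambda>t. N13 0"
      and R = "\<lambda>t. (prod_tab 0 0 0 (t *s e1),
        prod_tab 0 e1 0 e2)"])
  fix t :: complex assume "t \<notin> {0}"
  then show "(prod_tab 0 0 0 (t *s e1),
      prod_tab 0 e1 0 e2) \<in> orbit (N13 0)"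
    unfolding N13_def
    by (intro in_orbitI[where p = "(1 / t) *s e2" and q = "e1"])
      (simp_all add: table_simps field_simps power2_eq_square power3_eq_cube)
qed (rule listed_algebras_in_NP2 families_subset_NP2
  | force simp: N06_def prod_tab_def intro!: continuous_intros)+

lemma N13_degenerates_to_N05: "orbit N05 \<subseteq> np_closure (\<Union>\<gamma>. orbit (N13 \<gamma>))"
proof (rule degeneration[where B = "{0}" and X = "\<lambda>t. N13 (1 / t)"
      and R = "\<lambda>t. (prod_tab 0 0 0 (t *s e1),
        prod_tab 0 e1 0 (e1 + e2))"])
  fix t :: complex assume "t \<notin> {0}"
  then show "(prod_tab 0 0 0 (t *s e1),
      prod_tab 0 e1 0 (e1 + e2)) \<in> orbit (N13 (1 / t))"
    unfolding N13_def
    by (intro in_orbitI[where p = "(1 / t) *s e2" and q = "e1"])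
      (simp_all add: table_simps field_simps power2_eq_square power3_eq_cube)
qed (rule listed_algebras_in_NP2 families_subset_NP2
  | force simp: N05_def prod_tab_def intro!: continuous_intros)+

lemma N14_degenerates_to_N01: "orbit N01 \<subseteq> np_closure (\<Union>\<gamma>. orbit (N14 \<gamma>))"
proof (rule degeneration[where B = "{0}" and X = "\<lambda>t. N14 (1 / t)"
      and R = "\<lambda>t. (prod_tab (t *s e2) 0 0 0,
        prod_tab e2 0 0 0)"])
  fix t :: complex assume "t \<notin> {0}"
  then show "(prod_tab (t *s e2) 0 0 0,
      prod_tab e2 0 0 0) \<in> orbit (N14 (1 / t))"
    unfolding N14_def
    by (intro in_orbitI[where p = "e1" and q = "(1 / t) *s e2"])
      (simp_all add: table_simps field_simps power2_eq_square power3_eq_cube)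
qed (rule listed_algebras_in_NP2 families_subset_NP2
  | force simp: N01_def prod_tab_def intro!: continuous_intros)+

lemma N12_degenerates_to_N13: "orbit (N13 \<alpha>) \<subseteq> np_closure (\<Union>\<gamma>. orbit (N12 \<gamma>))"
proof (rule degeneration[where B = "{0}" and X = "\<lambda>t. N12 (1 / t)"
      and R = "\<lambda>t. (prod_tab e2 0 0 0,
        prod_tab (e1 + \<alpha> *s e2) (t *s e2) e2 0)"])
  fix t :: complex assume "t \<notin> {0}"
  then show "(prod_tab e2 0 0 0,
      prod_tab (e1 + \<alpha> *s e2) (t *s e2) e2 0) \<in> orbit (N12 (1 / t))"
    unfolding N12_def
    \<comment> \<open>The summand \<alpha> t e2 of \<open>p\<close> produces \<alpha> q in p \<circ>
      p, through the cross term from e1 \<circ> e2 = e2.\<close>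
    by (intro in_orbitI[where p = "t *s e1 + (\<alpha> * t) *s e2" and q = "t^2 *s e2"])
      (simp_all add: table_simps field_simps power2_eq_square power3_eq_cube)
qed (rule listed_algebras_in_NP2 families_subset_NP2
  | force simp: N13_def prod_tab_def intro!: continuous_intros)+

text \<open>Normalising p \<circ> q to \<open>p\<close> turns the parameter of \<open>N12\<close>
  into its inverse. Approaching \<alpha> through \<alpha> + t covers \<alpha> = 0 too, at the price
  of the exceptional value t = -\<alpha>.\<close>

lemma N12_degenerates_to_N06: "orbit (N06 \<alpha>) \<subseteq> np_closure (\<Union>\<gamma>. orbit (N12 \<gamma>))"
proof (rule degeneration[where B = "{0, - \<alpha>}" and X = "\<lambda>t. N12 (1 / (\<alpha> + t))"
      and R = "\<lambda>t. (prod_tab 0 0 0 (((\<alpha> + t)^2 * t) *s e1),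
        prod_tab 0 e1 ((\<alpha> + t) *s e1) e2)"])
  fix t :: complex assume t: "t \<notin> {0, - \<alpha>}"
  then have "\<alpha> + t \<noteq> 0" by (simp add: add_eq_0_iff)
  with t show "(prod_tab 0 0 0 (((\<alpha> + t)^2 * t) *s e1),
      prod_tab 0 e1 ((\<alpha> + t) *s e1) e2) \<in> orbit (N12 (1 / (\<alpha> + t)))"
    unfolding N12_def
    by (intro in_orbitI[where p = "(1 / t) *s e2" and q = "(\<alpha> + t) *s e1"])
      (simp_all add: table_simps field_simps power2_eq_square power3_eq_cube)
qed (rule listed_algebras_in_NP2 families_subset_NP2
  | force simp: N06_def prod_tab_def intro!: continuous_intros)+

text \<open>A version staying in one orbit: below \<open>N10\<close> and \<open>N07\<close>, only
  the member \<open>N12 1\<close> of its family is available.\<close>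

lemma N12_degenerates_to_N06_1: "orbit (N06 1) \<subseteq> np_closure (orbit (N12 1))"
proof (rule degeneration[where B = "{0}" and X = "\<lambda>t. N12 1"
      and R = "\<lambda>t. (prod_tab 0 0 0 (t *s e1),
        prod_tab 0 e1 e1 e2)"])
  fix t :: complex assume "t \<notin> {0}"
  then show "(prod_tab 0 0 0 (t *s e1),
      prod_tab 0 e1 e1 e2) \<in> orbit (N12 1)"
    unfolding N12_def
    by (intro in_orbitI[where p = "(1 / t) *s e2" and q = "e1"])
      (simp_all add: table_simps field_simps power2_eq_square power3_eq_cube)
qed (rule listed_algebras_in_NP2 families_subset_NP2
  | force simp: N06_def prod_tab_def intro!: continuous_intros)+

section \<open>Algebras whose commutative product is spanned by one idempotent\<close>

lemma N11_degenerates_to_N04: "orbit N04 \<subseteq> np_closure (\<Union>\<gamma>. orbit (N11 \<gamma>))"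
proof (rule degeneration[where B = "{0}" and X = "\<lambda>t. N11 (1 / t)"
      and R = "\<lambda>t. (prod_tab (t *s e1) 0 0 0,
        prod_tab e1 0 0 0)"])
  fix t :: complex assume "t \<notin> {0}"
  then show "(prod_tab (t *s e1) 0 0 0,
      prod_tab e1 0 0 0) \<in> orbit (N11 (1 / t))"
    unfolding N11_def
    by (intro in_orbitI[where p = "t *s e1" and q = "e2"])
      (simp_all add: table_simps field_simps power2_eq_square power3_eq_cube)
qed (rule listed_algebras_in_NP2 families_subset_NP2
  | force simp: N04_def prod_tab_def intro!: continuous_intros)+

lemma N11_degenerates_to_N14: "orbit (N14 \<alpha>) \<subseteq> np_closure (orbit (N11 \<alpha>))"
proof (rule degeneration[where B = "{0}" and X = "\<lambda>t. N11 \<alpha>"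
      and R = "\<lambda>t. (prod_tab (t *s e1 + e2) 0 0 0,
        prod_tab (\<alpha> *s (t *s e1 + e2)) 0 0 0)"])
  fix t :: complex assume "t \<notin> {0}"
  then show "(prod_tab (t *s e1 + e2) 0 0 0,
      prod_tab (\<alpha> *s (t *s e1 + e2)) 0 0 0) \<in> orbit (N11 \<alpha>)"
    unfolding N11_def
    \<comment> \<open>The shear makes p \<cdot> p = t^2 e1 = t p + q.\<close>
    by (intro in_orbitI[where p = "t *s e1 - e2" and q = "t *s e2"])
      (simp_all add: table_simps field_simps power2_eq_square power3_eq_cube)
qed (rule listed_algebras_in_NP2 families_subset_NP2
  | force simp: N14_def prod_tab_def intro!: continuous_intros)+

lemma N10_degenerates_to_N11: "orbit (N11 \<alpha>) \<subseteq> np_closure (orbit (N10 \<alpha>))"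
proof (rule degeneration[where B = "{0}" and X = "\<lambda>t. N10 \<alpha>"
      and R = "\<lambda>t. (prod_tab e1 0 0 0,
        prod_tab (\<alpha> *s e1) 0 0 (t *s e2))"])
  fix t :: complex assume "t \<notin> {0}"
  then show "(prod_tab e1 0 0 0,
      prod_tab (\<alpha> *s e1) 0 0 (t *s e2)) \<in> orbit (N10 \<alpha>)"
    unfolding N10_def
    by (intro in_orbitI[where p = "e1" and q = "t *s e2"])
      (simp_all add: table_simps field_simps power2_eq_square power3_eq_cube)
qed (rule listed_algebras_in_NP2 families_subset_NP2
  | force simp: N11_def prod_tab_def intro!: continuous_intros)+

lemma N10_degenerates_to_N03: "orbit N03 \<subseteq> np_closure (\<Union>\<gamma>. orbit (N10 \<gamma>))"
proof (rule degeneration[where B = "{0}" and X = "\<lambda>t. N10 (1 / t)"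
      and R = "\<lambda>t. (prod_tab (t *s e1) 0 0 0,
        prod_tab e1 0 0 e2)"])
  fix t :: complex assume "t \<notin> {0}"
  then show "(prod_tab (t *s e1) 0 0 0,
      prod_tab e1 0 0 e2) \<in> orbit (N10 (1 / t))"
    unfolding N10_def
    by (intro in_orbitI[where p = "t *s e1" and q = "e2"])
      (simp_all add: table_simps field_simps power2_eq_square power3_eq_cube)
qed (rule listed_algebras_in_NP2 families_subset_NP2
  | force simp: N03_def prod_tab_def intro!: continuous_intros)+

text \<open>Here \<open>p\<close> = t e1 + e2 is the unit for \<circ>, as e1 is in
  \<open>N12 1\<close>, and \<open>q\<close> solves p \<cdot> p = q - t p. On the idempotents t e1
  and e2 of \<circ>, \<open>q\<close> has the eigenvalues 2t and t, whence q \<circ> q = 3t q - 2t^2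
  p; both eigenvalues merge at 0.\<close>

lemma N10_degenerates_to_N12: "orbit (N12 1) \<subseteq> np_closure (\<Union>\<gamma>. orbit (N10 \<gamma>))"
proof (rule degeneration[where B = "{0}" and X = "\<lambda>t. N10 (1 / t)"
      and R = "\<lambda>t. (prod_tab (e2 - t *s e1) ((2 * t) *s (e2 - t *s e1))
        ((2 * t) *s (e2 - t *s e1)) ((4 * t^2) *s (e2 - t *s e1)),
        prod_tab e1 e2 e2 ((3 * t) *s e2 - (2 * t^2) *s e1))"])
  fix t :: complex assume "t \<notin> {0}"
  then show "(prod_tab (e2 - t *s e1) ((2 * t) *s (e2 - t *s e1))
        ((2 * t) *s (e2 - t *s e1)) ((4 * t^2) *s (e2 - t *s e1)),
      prod_tab e1 e2 e2 ((3 * t) *s e2 - (2 * t^2) *s e1)) \<in> orbit (N10 (1 / t))"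
    unfolding N10_def
    by (intro in_orbitI[where p = "t *s e1 + e2" and q = "(2 * t^2) *s e1 + t *s e2"])
      (simp_all add: table_simps field_simps power2_eq_square power3_eq_cube)
qed (rule listed_algebras_in_NP2 families_subset_NP2
  | force simp: N12_def prod_tab_def intro!: continuous_intros)+

section \<open>Algebras with unital commutative product\<close>

lemma N09_degenerates_to_N13: "orbit (N13 \<alpha>) \<subseteq> np_closure (\<Union>\<gamma> \<delta>. orbit (N09 \<gamma> \<delta>))"
proof (rule degeneration[where B = "{0}" and X = "\<lambda>t. N09 (1 / t) \<alpha>"
      and R = "\<lambda>t. (prod_tab (t *s e1 + e2) (t *s e2) (t *s e2) 0,
        prod_tab (e1 + \<alpha> *s e2) ((t * \<alpha>) *s e2) e2 0)"])
  fix t :: complex assume "t \<notin> {0}"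
  then show "(prod_tab (t *s e1 + e2) (t *s e2) (t *s e2) 0,
      prod_tab (e1 + \<alpha> *s e2) ((t * \<alpha>) *s e2) e2 0) \<in> orbit (N09 (1 / t) \<alpha>)"
    unfolding N09_def
    \<comment> \<open>The summand e2 of \<open>p\<close> serves twice: p \<cdot> p = t p + q, and p
      \<circ> p = p + \<alpha> q.\<close>
    by (intro in_orbitI[where p = "t *s e1 + e2" and q = "t *s e2"])
      (simp_all add: table_simps field_simps power2_eq_square power3_eq_cube)
qed (rule listed_algebras_in_NP2 families_subset_NP2
  | force simp: N13_def prod_tab_def intro!: continuous_intros)+

lemma N09_degenerates_to_N06: "orbit (N06 \<alpha>) \<subseteq> np_closure (\<Union>\<gamma> \<delta>. orbit (N09 \<gamma> \<delta>))"
proof (rule degeneration[where B = "{0}" and X = "\<lambda>t. N09 (1 / t) (\<alpha> / t)"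
      and R = "\<lambda>t. (prod_tab 0 (t *s e1) (t *s e1) (t *s e2),
        prod_tab 0 e1 (\<alpha> *s e1) e2)"])
  fix t :: complex assume "t \<notin> {0}"
  then show "(prod_tab 0 (t *s e1) (t *s e1) (t *s e2),
      prod_tab 0 e1 (\<alpha> *s e1) e2) \<in> orbit (N09 (1 / t) (\<alpha> / t))"
    unfolding N09_def
    by (intro in_orbitI[where p = "e2" and q = "t *s e1"])
      (simp_all add: table_simps field_simps power2_eq_square power3_eq_cube)
qed (rule listed_algebras_in_NP2 families_subset_NP2
  | force simp: N06_def prod_tab_def intro!: continuous_intros)+

lemma N08_degenerates_to_N09: "orbit (N09 \<alpha> \<beta>) \<subseteq> np_closure (orbit (N08 \<alpha> \<beta>))"
proof (rule degeneration[where B = "{0}" and X = "\<lambda>t. N08 \<alpha> \<beta>"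
      and R = "\<lambda>t. (prod_tab e1 e2 e2 0,
        prod_tab (\<alpha> *s e1 + t *s e2) (\<beta> *s e2) (\<alpha> *s e2) 0)"])
  fix t :: complex assume "t \<notin> {0}"
  then show "(prod_tab e1 e2 e2 0,
      prod_tab (\<alpha> *s e1 + t *s e2) (\<beta> *s e2) (\<alpha> *s e2) 0) \<in> orbit (N08 \<alpha> \<beta>)"
    unfolding N08_def
    by (intro in_orbitI[where p = "e1" and q = "(1 / t) *s e2"])
      (simp_all add: table_simps field_simps power2_eq_square power3_eq_cube)
qed (rule listed_algebras_in_NP2 families_subset_NP2
  | force simp: N09_def prod_tab_def intro!: continuous_intros)+

lemma N08_degenerates_to_N12: "orbit (N12 \<alpha>) \<subseteq> np_closure (\<Union>\<gamma> \<delta>. orbit (N08 \<gamma> \<delta>))"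
proof (rule degeneration[where B = "{0}" and X = "\<lambda>t. N08 (\<alpha> / t) (1 / t)"
      and R = "\<lambda>t. (prod_tab (t *s e1 + e2) (t *s e2) (t *s e2) 0,
        prod_tab (\<alpha> *s e1) e2 (\<alpha> *s e2) 0)"])
  fix t :: complex assume "t \<notin> {0}"
  then show "(prod_tab (t *s e1 + e2) (t *s e2) (t *s e2) 0,
      prod_tab (\<alpha> *s e1) e2 (\<alpha> *s e2) 0) \<in> orbit (N08 (\<alpha> / t) (1 / t))"
    unfolding N08_def
    \<comment> \<open>The coefficient -t^2 cancels the e2 term of e1 \<circ> e1 against e1 \<circ>
      e2 = e2 / t, so that p \<circ> p = \<alpha> p; then \<open>q\<close> is forced by p \<cdot> p
      = t p + q.\<close>
    by (intro in_orbitI[where p = "t *s e1 + (- (t^2)) *s e2" and q = "(- (t^3)) *s e2"])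
      (simp_all add: table_simps field_simps power2_eq_square power3_eq_cube)
qed (rule listed_algebras_in_NP2 families_subset_NP2
  | force simp: N12_def prod_tab_def intro!: continuous_intros)+

lemma N07_degenerates_to_N10: "orbit (N10 \<alpha>) \<subseteq> np_closure (\<Union>\<gamma> \<delta>. orbit (N07 \<gamma> \<delta>))"
proof (rule degeneration[where B = "{0}" and X = "\<lambda>t. N07 \<alpha> (1 / t)"
      and R = "\<lambda>t. (prod_tab e1 0 0 (t *s e2),
        prod_tab (\<alpha> *s e1) 0 0 e2)"])
  fix t :: complex assume "t \<notin> {0}"
  then show "(prod_tab e1 0 0 (t *s e2),
      prod_tab (\<alpha> *s e1) 0 0 e2) \<in> orbit (N07 \<alpha> (1 / t))"
    unfolding N07_def
    by (intro in_orbitI[where p = "e1" and q = "t *s e2"])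
      (simp_all add: table_simps field_simps power2_eq_square power3_eq_cube)
qed (rule listed_algebras_in_NP2 families_subset_NP2
  | force simp: N10_def prod_tab_def intro!: continuous_intros)+

text \<open>With \<open>p\<close> = e1 + e2, the unit for \<cdot>, the two parameters \<alpha> + t
  and \<alpha> differ by t, which leaves p \<circ> p = \<alpha> p + q for \<open>q\<close> = t e1.
  As they merge, \<open>q\<close> becomes nilpotent for \<cdot>.\<close>

lemma N07_degenerates_to_N08: "orbit (N08 \<alpha> \<alpha>) \<subseteq> np_closure (\<Union>\<gamma> \<delta>. orbit (N07 \<gamma> \<delta>))"
proof (rule degeneration[where B = "{0}" and X = "\<lambda>t. N07 (\<alpha> + t) \<alpha>"
      and R = "\<lambda>t. (prod_tab e1 e2 e2 (t *s e2),
        prod_tab (\<alpha> *s e1 + e2) ((\<alpha> + t) *s e2)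
        ((\<alpha> + t) *s e2) (((\<alpha> + t) * t) *s e2))"])
  fix t :: complex assume "t \<notin> {0}"
  then show "(prod_tab e1 e2 e2 (t *s e2),
      prod_tab (\<alpha> *s e1 + e2) ((\<alpha> + t) *s e2)
        ((\<alpha> + t) *s e2) (((\<alpha> + t) * t) *s e2)) \<in> orbit (N07 (\<alpha> + t) \<alpha>)"
    unfolding N07_def
    by (intro in_orbitI[where p = "e1 + e2" and q = "t *s e1"])
      (simp_all add: table_simps field_simps power2_eq_square power3_eq_cube)
qed (rule listed_algebras_in_NP2 families_subset_NP2
  | force simp: N08_def prod_tab_def intro!: continuous_intros)+

section \<open>Combining the primary degenerations\<close>

theorem lemma42:
  shows
   "(\<forall>T \<in> {N05, N02, N01, C8}.
        np_closure (orbit T) \<subseteq> np_closure (\<Union>\<gamma>. orbit (N06 \<gamma>)))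
  \<and> (\<forall>\<alpha>. \<forall>T \<in> {N14 \<alpha>, N12 1, N11 \<alpha>, N10 \<alpha>, N09 \<alpha> \<alpha>, N08 \<alpha> \<alpha>, N06 1, N04, N03, N01, C8}.
        np_closure (orbit T) \<subseteq> np_closure (\<Union>\<gamma> \<delta>. orbit (N07 \<gamma> \<delta>)))
  \<and> (\<forall>\<alpha> \<beta>. \<forall>T \<in> {N14 \<alpha>, N13 \<alpha>, N12 \<alpha>, N09 \<alpha> \<beta>, N06 \<alpha>, N05, N02, N01, C8}.
        np_closure (orbit T) \<subseteq> np_closure (\<Union>\<gamma> \<delta>. orbit (N08 \<gamma> \<delta>)))
  \<and> (\<forall>\<alpha>. \<forall>T \<in> {N14 \<alpha>, N13 \<alpha>, N06 \<alpha>, N05, N02, N01, C8}.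
        np_closure (orbit T) \<subseteq> np_closure (\<Union>\<gamma> \<delta>. orbit (N09 \<gamma> \<delta>)))
  \<and> (\<forall>\<alpha>. \<forall>T \<in> {N14 \<alpha>, N12 1, N11 \<alpha>, N06 1, N04, N03, N01, C8}.
        np_closure (orbit T) \<subseteq> np_closure (\<Union>\<gamma>. orbit (N10 \<gamma>)))
  \<and> (\<forall>\<alpha>. \<forall>T \<in> {N14 \<alpha>, N04, N01, C8}.
        np_closure (orbit T) \<subseteq> np_closure (\<Union>\<gamma>. orbit (N11 \<gamma>)))
  \<and> (\<forall>\<alpha>. \<forall>T \<in> {N14 \<alpha>, N13 \<alpha>, N06 \<alpha>, N05, N02, N01, C8}.
        np_closure (orbit T) \<subseteq> np_closure (\<Union>\<gamma>. orbit (N12 \<gamma>)))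
  \<and> (\<forall>\<alpha>. \<forall>T \<in> {N14 \<alpha>, N06 0, N05, N01, C8}.
        np_closure (orbit T) \<subseteq> np_closure (\<Union>\<gamma>. orbit (N13 \<gamma>)))
  \<and> (\<forall>T \<in> {N01, C8}.
        np_closure (orbit T) \<subseteq> np_closure (\<Union>\<gamma>. orbit (N14 \<gamma>)))"
proof -
  have members:
    "\<And>\<alpha>. np_closure (orbit (N06 \<alpha>)) \<subseteq> np_closure (\<Union>\<gamma>. orbit (N06 \<gamma>))"
    "\<And>\<alpha>. np_closure (orbit (N10 \<alpha>)) \<subseteq> np_closure (\<Union>\<gamma>. orbit (N10 \<gamma>))"
    "\<And>\<alpha>. np_closure (orbit (N11 \<alpha>)) \<subseteq> np_closure (\<Union>\<gamma>. orbit (N11 \<gamma>))"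
    "\<And>\<alpha>. np_closure (orbit (N12 \<alpha>)) \<subseteq> np_closure (\<Union>\<gamma>. orbit (N12 \<gamma>))"
    "\<And>\<alpha>. np_closure (orbit (N13 \<alpha>)) \<subseteq> np_closure (\<Union>\<gamma>. orbit (N13 \<gamma>))"
    "\<And>\<alpha>. np_closure (orbit (N14 \<alpha>)) \<subseteq> np_closure (\<Union>\<gamma>. orbit (N14 \<gamma>))"
    "\<And>\<alpha> \<beta>. np_closure (orbit (N08 \<alpha> \<beta>)) \<subseteq> np_closure (\<Union>\<gamma> \<delta>. orbit (N08 \<gamma> \<delta>))"
    by (intro np_closure_mono; blast)+
  \<comment> \<open>Inclusions between whole families: each member of the smaller family is a limit
    of the larger one, and a closed set containing all these orbits contains the closure of their
    union.\<close>
  have families: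
    "np_closure (\<Union>\<gamma>. orbit (N14 \<gamma>)) \<subseteq> np_closure (\<Union>\<gamma>. orbit (N11 \<gamma>))"
    "np_closure (\<Union>\<gamma>. orbit (N14 \<gamma>)) \<subseteq> np_closure (\<Union>\<gamma>. orbit (N13 \<gamma>))"
    "np_closure (\<Union>\<gamma>. orbit (N11 \<gamma>)) \<subseteq> np_closure (\<Union>\<gamma>. orbit (N10 \<gamma>))"
    "np_closure (\<Union>\<gamma> \<delta>. orbit (N09 \<gamma> \<delta>)) \<subseteq> np_closure (\<Union>\<gamma> \<delta>. orbit (N08 \<gamma> \<delta>))"
    "np_closure (\<Union>\<gamma>. orbit (N06 \<gamma>)) \<subseteq> np_closure (\<Union>\<gamma>. orbit (N12 \<gamma>))"
    "np_closure (\<Union>\<gamma>. orbit (N06 \<gamma>)) \<subseteq> np_closure (\<Union>\<gamma> \<delta>. orbit (N09 \<gamma> \<delta>))"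
    "np_closure (\<Union>\<gamma>. orbit (N10 \<gamma>)) \<subseteq> np_closure (\<Union>\<gamma> \<delta>. orbit (N07 \<gamma> \<delta>))"
    "np_closure (\<Union>\<gamma>. orbit (N12 \<gamma>)) \<subseteq> np_closure (\<Union>\<gamma> \<delta>. orbit (N08 \<gamma> \<delta>))"
    "np_closure (\<Union>\<gamma>. orbit (N13 \<gamma>)) \<subseteq> np_closure (\<Union>\<gamma> \<delta>. orbit (N09 \<gamma> \<delta>))"
    "np_closure (\<Union>\<gamma>. orbit (N13 \<gamma>)) \<subseteq> np_closure (\<Union>\<gamma>. orbit (N12 \<gamma>))"
    by (intro np_closure_least UN_least order_trans[OF N11_degenerates_to_N14 members(3)]
        order_trans[OF N13_degenerates_to_N14 members(5)]
        order_trans[OF N10_degenerates_to_N11 members(2)]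
        order_trans[OF N08_degenerates_to_N09 members(7)]
        N12_degenerates_to_N06 N09_degenerates_to_N06
        N07_degenerates_to_N10 N08_degenerates_to_N12
        N09_degenerates_to_N13 N12_degenerates_to_N13)+
  note C8 = N01_degenerates_to_C8[THEN np_closure_least]
  \<comment> \<open>Each list collects orbit closures below one family; some also list the family's
    own members, so that \<open>order_trans\<close> with \<open>families\<close> carries them up to
    larger families.\<close>
  note below_N14 = N14_degenerates_to_N01[THEN np_closure_least]
    order_trans[OF C8 N14_degenerates_to_N01[THEN np_closure_least]]
    members(6)
  note below_N13 = below_N14[THEN order_trans, OF families(2)]
    N13_degenerates_to_N05[THEN np_closure_least]
    order_trans[OF N13_degenerates_to_N06[THEN np_closure_least] members(5)]
    members(5)
  note below_N06 = N06_degenerates_to_N05[THEN np_closure_least]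
    N06_degenerates_to_N02[THEN np_closure_least]
    order_trans[OF N05_degenerates_to_N01[THEN np_closure_least] N06_degenerates_to_N05[THEN np_closure_least]]
    order_trans[OF order_trans[OF C8 N05_degenerates_to_N01[THEN np_closure_least]]
      N06_degenerates_to_N05[THEN np_closure_least]]
    members(1)
  note below_N12 = below_N13[THEN order_trans, OF families(10)]
    below_N06[THEN order_trans, OF families(5)]
    members(4)
  note below_N09 = below_N13[THEN order_trans, OF families(9)]
    below_N06[THEN order_trans, OF families(6)]
  note below_N11 = below_N14[THEN order_trans, OF families(1)]
    N11_degenerates_to_N04[THEN np_closure_least]
    members(3)
  note below_N10 = below_N11[THEN order_trans, OF families(3)]
    N10_degenerates_to_N03[THEN np_closure_least]
    N10_degenerates_to_N12[THEN np_closure_least]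
    order_trans[OF N12_degenerates_to_N06_1[THEN np_closure_least] N10_degenerates_to_N12[THEN np_closure_least]]
    members(2)
  note below_N08 = below_N09[THEN order_trans, OF families(4)]
    below_N12[THEN order_trans, OF families(8)]
    order_trans[OF N08_degenerates_to_N09[THEN np_closure_least] members(7)]
  \<comment> \<open>Only the diagonal members \<open>N08 \<alpha> \<alpha>\<close> are reached here,
    hence also only \<open>N09 \<alpha> \<alpha>\<close> through them.\<close>
  note below_N07 = below_N10[THEN order_trans, OF families(7)]
    N07_degenerates_to_N08[THEN np_closure_least]
    order_trans[OF N08_degenerates_to_N09[THEN np_closure_least] N07_degenerates_to_N08[THEN np_closure_least]]
  show ?thesis
    by (intro conjI allI ballI; elim insertE emptyE; hypsubst)
      (rule below_N06 below_N07 below_N08 below_N09 below_N10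
        below_N11 below_N12 below_N13 below_N14)+
qed

end
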